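(* Let $\mathcal{D}$ be a well generated triangulated category and let $\sigma_1,\sigma_2$ be objects of $\mathcal{D}$ such that $\mathrm{Hom}_{\mathcal{D}}(\sigma_1,\sigma_1[k])=0$ and $\mathrm{Hom}_{\mathcal{D}}(\sigma_2,\sigma_2[k])=0$ for all $k>0$, $\mathrm{Hom}_{\mathcal{D}}(\sigma_1,\sigma_2[k])=0$ for all $k\ge 0$, and $\mathrm{Hom}_{\mathcal{D}}(\sigma_2,\sigma_1[k])=0$ for all $k\ge 2$. Let $\alpha\colon\sigma_2\to\sigma_1[1]$ be a morphism and let $\tilde\sigma$ be the object defined by the triangle $$\sigma_1\to\tilde\sigma\to\sigma_2\xrightarrow{\alpha}\sigma_1[1].$$ Then $\mathrm{Hom}_{\mathcal{D}}(\tilde\sigma,\tilde\sigma[k])=0$ for all $k>0$ if and only if the homomorphism $$\varphi\colon \mathrm{Hom}_{\mathcal{D}}(\sigma_2,\sigma_2)\oplus\mathrm{Hom}_{\mathcal{D}}(\sigma_1[1],\sigma_1[1])\to\mathrm{Hom}_{\mathcal{D}}(\sigma_2,\sigma_1[1]),\qquad (f,g)\mapsto\alpha\circ f+g\circ\alpha$$ is surjective.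
   Context: Well generated is meant in the sense of Neeman/Krause. $[1]$ denotes the shift functor. *)

theory Defs
  imports "HOL-Algebra.Group"
begin

unbundle cardinal_syntax

section \<open>Categories\<close>

record ('o, 'm) cat =
  Ob :: "'o set"
  Arr :: "'m set"
  Dom :: "'m \<Rightarrow> 'o"
  Cod :: "'m \<Rightarrow> 'o"
  Ident :: "'o \<Rightarrow> 'm"
  Comp :: "'m \<Rightarrow> 'm \<Rightarrow> 'm"  (infixr \<open>\<cdot>\<index>\<close> 70)

definition Hom :: "('o, 'm, 'x) cat_scheme \<Rightarrow> 'o \<Rightarrow> 'o \<Rightarrow> 'm set" where
  "Hom C X Y = {f \<in> Arr C. Dom C f = X \<and> Cod C f = Y}"

locale cat =
  fixes C :: "('o, 'm, 'x) cat_scheme" (structure)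
  assumes Dom_Ob: "f \<in> Arr C \<Longrightarrow> Dom C f \<in> Ob C"
    and Cod_Ob: "f \<in> Arr C \<Longrightarrow> Cod C f \<in> Ob C"
    and Ident_Hom: "X \<in> Ob C \<Longrightarrow> Ident C X \<in> Hom C X X"
    and Comp_Hom: "\<lbrakk>f \<in> Hom C X Y; g \<in> Hom C Y Z\<rbrakk> \<Longrightarrow> g \<cdot> f \<in> Hom C X Z"
    and Comp_assoc: "\<lbrakk>f \<in> Hom C W X; g \<in> Hom C X Y; h \<in> Hom C Y Z\<rbrakk>
          \<Longrightarrow> (h \<cdot> g) \<cdot> f = h \<cdot> (g \<cdot> f)"
    and Comp_Ident: "f \<in> Hom C X Y \<Longrightarrow> f \<cdot> Ident C X = f"
    and Ident_Comp: "f \<in> Hom C X Y \<Longrightarrow> Ident C Y \<cdot> f = f"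

definition is_iso_arr :: "('o, 'm, 'x) cat_scheme \<Rightarrow> 'm \<Rightarrow> bool" where
  "is_iso_arr C f \<longleftrightarrow> f \<in> Arr C \<and>
     (\<exists>g \<in> Hom C (Cod C f) (Dom C f).
        g \<cdot>\<^bsub>C\<^esub> f = Ident C (Dom C f) \<and> f \<cdot>\<^bsub>C\<^esub> g = Ident C (Cod C f))"

definition is_zero_ob :: "('o, 'm, 'x) cat_scheme \<Rightarrow> 'o \<Rightarrow> bool" where
  "is_zero_ob C Z \<longleftrightarrow> Z \<in> Ob C \<and>
     (\<forall>X \<in> Ob C. (\<exists>!f. f \<in> Hom C X Z) \<and> (\<exists>!f. f \<in> Hom C Z X))"

definition is_coproduct ::
  "('o, 'm, 'x) cat_scheme \<Rightarrow> 'i set \<Rightarrow> ('i \<Rightarrow> 'o) \<Rightarrow> 'o \<Rightarrow> ('i \<Rightarrow> 'm) \<Rightarrow> bool" where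
  "is_coproduct C I X P \<iota> \<longleftrightarrow> P \<in> Ob C \<and> (\<forall>i \<in> I. X i \<in> Ob C \<and> \<iota> i \<in> Hom C (X i) P) \<and>
     (\<forall>Z \<in> Ob C. \<forall>f. (\<forall>i \<in> I. f i \<in> Hom C (X i) Z) \<longrightarrow>
        (\<exists>!h. h \<in> Hom C P Z \<and> (\<forall>i \<in> I. h \<cdot>\<^bsub>C\<^esub> \<iota> i = f i)))"


section \<open>Additive categories\<close>

record ('o, 'm) add_cat = "('o, 'm) cat" +
  Add :: "'m \<Rightarrow> 'm \<Rightarrow> 'm"  (infixl \<open>\<boxplus>\<index>\<close> 65)
  Zero :: "'o \<Rightarrow> 'o \<Rightarrow> 'm"

text \<open>The additive group of morphisms, written as a (multiplicative) HOL-Algebra group.\<close>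

definition Hom_grp :: "('o, 'm, 'x) add_cat_scheme \<Rightarrow> 'o \<Rightarrow> 'o \<Rightarrow> 'm monoid" where
  "Hom_grp C X Y = \<lparr>carrier = Hom C X Y, monoid.mult = Add C, one = Zero C X Y\<rparr>"

definition Neg :: "('o, 'm, 'x) add_cat_scheme \<Rightarrow> 'm \<Rightarrow> 'm" where
  "Neg C f = inv\<^bsub>Hom_grp C (Dom C f) (Cod C f)\<^esub> f"

locale additive_category = cat C
  for C :: "('o, 'm, 'x) add_cat_scheme" (structure) +
  assumes Hom_comm_group: "\<lbrakk>X \<in> Ob C; Y \<in> Ob C\<rbrakk> \<Longrightarrow> comm_group (Hom_grp C X Y)"
    and Comp_Add: "\<lbrakk>f \<in> Hom C X Y; f' \<in> Hom C X Y; g \<in> Hom C Y Z\<rbrakk>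
          \<Longrightarrow> g \<cdot> (f \<boxplus> f') = g \<cdot> f \<boxplus> g \<cdot> f'"
    and Add_Comp: "\<lbrakk>f \<in> Hom C X Y; g \<in> Hom C Y Z; g' \<in> Hom C Y Z\<rbrakk>
          \<Longrightarrow> (g \<boxplus> g') \<cdot> f = g \<cdot> f \<boxplus> g' \<cdot> f"
    and zero_ob_exists: "\<exists>Z. is_zero_ob C Z"
    and biproduct_exists: "\<lbrakk>X \<in> Ob C; Y \<in> Ob C\<rbrakk> \<Longrightarrow>
          \<exists>P \<in> Ob C. \<exists>i \<in> Hom C X P. \<exists>j \<in> Hom C Y P. \<exists>p \<in> Hom C P X. \<exists>q \<in> Hom C P Y.
            p \<cdot> i = Ident C X \<and> q \<cdot> j = Ident C Y \<and>
            p \<cdot> j = Zero C Y X \<and> q \<cdot> i = Zero C X Y \<and>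
            i \<cdot> p \<boxplus> j \<cdot> q = Ident C P"


section \<open>Triangulated categories\<close>

text \<open>A triple \<open>(u, v, w)\<close> in \<open>Tri\<close> stands for the distinguished triangle
  \<open>X \<rightarrow> Y \<rightarrow> Z \<rightarrow> X[1]\<close> with consecutive morphisms \<open>u\<close>, \<open>v\<close>, \<open>w\<close>; the objects are recovered
  from the domains and codomains.\<close>

record ('o, 'm) tri_cat = "('o, 'm) add_cat" +
  Shift_ob :: "'o \<Rightarrow> 'o"
  Shift :: "'m \<Rightarrow> 'm"
  Tri :: "('m \<times> 'm \<times> 'm) set"

definition candidate_triangle ::
  "('o, 'm, 'x) tri_cat_scheme \<Rightarrow> 'o \<Rightarrow> 'o \<Rightarrow> 'o \<Rightarrow> 'm \<Rightarrow> 'm \<Rightarrow> 'm \<Rightarrow> bool" where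
  "candidate_triangle C X Y Z u v w \<longleftrightarrow> X \<in> Ob C \<and> Y \<in> Ob C \<and> Z \<in> Ob C \<and>
     u \<in> Hom C X Y \<and> v \<in> Hom C Y Z \<and> w \<in> Hom C Z (Shift_ob C X)"

definition triangle ::
  "('o, 'm, 'x) tri_cat_scheme \<Rightarrow> 'o \<Rightarrow> 'o \<Rightarrow> 'o \<Rightarrow> 'm \<Rightarrow> 'm \<Rightarrow> 'm \<Rightarrow> bool" where
  "triangle C X Y Z u v w \<longleftrightarrow> candidate_triangle C X Y Z u v w \<and> (u, v, w) \<in> Tri C"

text \<open>The shift is an additive autoequivalence: fully faithful and essentially surjective, but not
  necessarily bijective on objects.\<close>

locale triangulated_category = additive_category C
  for C :: "('o, 'm, 'x) tri_cat_scheme" (structure) +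
  assumes Shift_Ob: "X \<in> Ob C \<Longrightarrow> Shift_ob C X \<in> Ob C"
    and Shift_Hom: "f \<in> Hom C X Y \<Longrightarrow> Shift C f \<in> Hom C (Shift_ob C X) (Shift_ob C Y)"
    and Shift_Ident: "X \<in> Ob C \<Longrightarrow> Shift C (Ident C X) = Ident C (Shift_ob C X)"
    and Shift_Comp: "\<lbrakk>f \<in> Hom C X Y; g \<in> Hom C Y Z\<rbrakk>
          \<Longrightarrow> Shift C (g \<cdot> f) = Shift C g \<cdot> Shift C f"
    and Shift_Add: "\<lbrakk>f \<in> Hom C X Y; f' \<in> Hom C X Y\<rbrakk>
          \<Longrightarrow> Shift C (f \<boxplus> f') = Shift C f \<boxplus> Shift C f'"
    and Shift_fully_faithful: "\<lbrakk>X \<in> Ob C; Y \<in> Ob C\<rbrakk>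
          \<Longrightarrow> bij_betw (Shift C) (Hom C X Y) (Hom C (Shift_ob C X) (Shift_ob C Y))"
    and Shift_ess_surj: "Y \<in> Ob C
          \<Longrightarrow> \<exists>X \<in> Ob C. \<exists>f \<in> Hom C (Shift_ob C X) Y. is_iso_arr C f"
    and Tri_candidate: "(u, v, w) \<in> Tri C
          \<Longrightarrow> candidate_triangle C (Dom C u) (Cod C u) (Cod C v) u v w"
    and TR1_id: "\<lbrakk>X \<in> Ob C; is_zero_ob C Z\<rbrakk>
          \<Longrightarrow> triangle C X X Z (Ident C X) (Zero C X Z) (Zero C Z (Shift_ob C X))"
    and TR1_ex: "u \<in> Hom C X Y \<Longrightarrow> \<exists>Z v w. triangle C X Y Z u v w"
    and TR1_iso: "\<lbrakk>triangle C X Y Z u v w; candidate_triangle C X' Y' Z' u' v' w';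
          f \<in> Hom C X X'; g \<in> Hom C Y Y'; h \<in> Hom C Z Z';
          is_iso_arr C f; is_iso_arr C g; is_iso_arr C h;
          g \<cdot> u = u' \<cdot> f; h \<cdot> v = v' \<cdot> g; Shift C f \<cdot> w = w' \<cdot> h\<rbrakk>
          \<Longrightarrow> triangle C X' Y' Z' u' v' w'"
    and TR2: "candidate_triangle C X Y Z u v w \<Longrightarrow>
          triangle C X Y Z u v w \<longleftrightarrow> triangle C Y Z (Shift_ob C X) v w (Neg C (Shift C u))"
    and TR3: "\<lbrakk>triangle C X Y Z u v w; triangle C X' Y' Z' u' v' w';
          f \<in> Hom C X X'; g \<in> Hom C Y Y'; g \<cdot> u = u' \<cdot> f\<rbrakk>
          \<Longrightarrow> \<exists>h \<in> Hom C Z Z'. h \<cdot> v = v' \<cdot> g \<and> Shift C f \<cdot> w = w' \<cdot> h"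
    and TR4: "\<lbrakk>triangle C X Y Z' u i i'; triangle C Y Z X' v j j'; triangle C X Z Y' (v \<cdot> u) k k'\<rbrakk>
          \<Longrightarrow> \<exists>f g. triangle C Z' Y' X' f g (Shift C i \<cdot> j') \<and>
                 f \<cdot> i = k \<cdot> v \<and> k' \<cdot> f = i' \<and> g \<cdot> k = j \<and> j' \<cdot> g = Shift C u \<cdot> k'"

definition shift_by :: "('o, 'm, 'x) tri_cat_scheme \<Rightarrow> nat \<Rightarrow> 'o \<Rightarrow> 'o" where
  "shift_by C k X = (Shift_ob C ^^ k) X"


section \<open>Well generated triangulated categories\<close>

text \<open>Set-theoretic size is measured against a Grothendieck universe, given by a set \<open>U\<close> whose
  cardinality is uncountable, regular and a strong limit. A set (of any type) is small if it has
  smaller cardinality than \<open>U\<close>. Up to bijection, every small set is a subset of \<open>U\<close>, so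
  index sets and cardinals can be taken in the type of \<open>U\<close>.\<close>

definition strongly_inaccessible :: "'u set \<Rightarrow> bool" where
  "strongly_inaccessible U \<longleftrightarrow> natLeq <o |U| \<and> regularCard |U| \<and>
     (\<forall>A :: 'u set. |A| <o |U| \<longrightarrow> |Pow A| <o |U| )"

definition small :: "'u set \<Rightarrow> 'a set \<Rightarrow> bool" where
  "small U A \<longleftrightarrow> |A| <o |U|"

definition locally_small :: "'u set \<Rightarrow> ('o, 'm, 'x) cat_scheme \<Rightarrow> bool" where
  "locally_small U C \<longleftrightarrow> (\<forall>X \<in> Ob C. \<forall>Y \<in> Ob C. small U (Hom C X Y))"

definition has_small_coproducts :: "'u set \<Rightarrow> ('o, 'm, 'x) cat_scheme \<Rightarrow> bool" where
  "has_small_coproducts U C \<longleftrightarrow> (\<forall>(I :: 'u set) X. small U I \<and> (\<forall>i \<in> I. X i \<in> Ob C) \<longrightarrow>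
     (\<exists>P \<iota>. is_coproduct C I X P \<iota>))"

text \<open>\<open>alpha_small_ob U C K S\<close>: for \<open>\<alpha> = |K|\<close>, every morphism from \<open>S\<close> to a small coproduct
  factors through the subcoproduct on fewer than \<open>\<alpha>\<close> of its summands.\<close>

definition alpha_small_ob :: "'u set \<Rightarrow> ('o, 'm, 'x) cat_scheme \<Rightarrow> 'u set \<Rightarrow> 'o \<Rightarrow> bool" where
  "alpha_small_ob U C K S \<longleftrightarrow>
     (\<forall>(I :: 'u set) Y Q \<kappa>. \<forall>f \<in> Hom C S Q. small U I \<and> is_coproduct C I Y Q \<kappa> \<longrightarrow>
        (\<exists>J \<subseteq> I. |J| <o |K| \<and>
           (\<exists>R \<rho>. is_coproduct C J Y R \<rho> \<and>
              (\<exists>h \<in> Hom C R Q. \<exists>g \<in> Hom C S R.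
                 (\<forall>j \<in> J. h \<cdot>\<^bsub>C\<^esub> \<rho> j = \<kappa> j) \<and> f = h \<cdot>\<^bsub>C\<^esub> g))))"

definition post_surj :: "('o, 'm, 'x) cat_scheme \<Rightarrow> 'o \<Rightarrow> 'm \<Rightarrow> bool" where
  "post_surj C S f \<longleftrightarrow>
     (\<lambda>t. f \<cdot>\<^bsub>C\<^esub> t) ` Hom C S (Dom C f) = Hom C S (Cod C f)"

text \<open>Krause's definition (``On Neeman's well generated triangulated categories''), equivalent
  to Neeman's: there are small coproducts and a small set of objects \<open>\<S>\<close> such that
  (G1) \<open>\<S>\<close> detects zero objects, (G2) a small coproduct of \<open>\<S>\<close>-surjective morphisms is
  \<open>\<S>\<close>-surjective, and (G3) all objects of \<open>\<S>\<close> are \<open>\<alpha>\<close>-small for some regular cardinal \<open>\<alpha>\<close>.\<close>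

definition well_generated :: "'u set \<Rightarrow> ('o, 'm, 'x) tri_cat_scheme \<Rightarrow> bool" where
  "well_generated U C \<longleftrightarrow>
     triangulated_category C \<and> locally_small U C \<and> has_small_coproducts U C \<and>
     (\<exists>\<S> \<subseteq> Ob C. small U \<S> \<and>
        (\<forall>X \<in> Ob C. (\<forall>S \<in> \<S>. Hom C S X = {Zero C S X}) \<longrightarrow> is_zero_ob C X) \<and>
        (\<forall>(I :: 'u set) X Y f P \<iota> Q \<kappa> h.
           small U I \<and> (\<forall>i \<in> I. f i \<in> Hom C (X i) (Y i)) \<and>
           is_coproduct C I X P \<iota> \<and> is_coproduct C I Y Q \<kappa> \<and>
           h \<in> Hom C P Q \<and> (\<forall>i \<in> I. h \<cdot>\<^bsub>C\<^esub> \<iota> i = \<kappa> i \<cdot>\<^bsub>C\<^esub> f i) \<and>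
           (\<forall>i \<in> I. \<forall>S \<in> \<S>. post_surj C S (f i)) \<longrightarrow>
           (\<forall>S \<in> \<S>. post_surj C S h)) \<and>
        (\<exists>K :: 'u set. small U K \<and> infinite K \<and> regularCard |K| \<and>
           (\<forall>S \<in> \<S>. alpha_small_ob U C K S)))"

end

theory Submission
  imports Defs
begin

text \<open>
  Write \<open>A = \<sigma>\<^sub>1\<close>, \<open>B = \<sigma>\<^sub>2\<close>, \<open>E = \<sigma>'\<close>, so that \<open>A \<rightarrow> E \<rightarrow> B \<rightarrow> A[1]\<close> is the given triangle, and let
  \<open>j = - \<iota>[1]\<close> be the morphism \<open>A[1] \<rightarrow> E[1]\<close> of the rotated triangle. Everything rests on the
  exactness of the functors \<open>Hom(T, -)\<close> and \<open>Hom(-, T)\<close> on triangles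
  (\<open>triangle_factor_left\<close> and \<open>triangle_factor_right\<close>).

  The vanishing hypotheses and exactness give \<open>Hom(B, E[k]) = 0\<close> for \<open>k \<ge> 2\<close> and
  \<open>Hom(A, E[k]) = 0\<close> for \<open>k \<ge> 1\<close>, hence \<open>Hom(E, E[k]) = 0\<close> for all \<open>k \<ge> 2\<close> unconditionally.
  Only \<open>k = 1\<close> remains. Because \<open>Hom(A, E[1])\<close> and \<open>Hom(B, B[1])\<close> vanish, every morphism
  \<open>E \<rightarrow> E[1]\<close> has the form \<open>j h \<pi>\<close> with \<open>h : B \<rightarrow> A[1]\<close>. It is zero if and only if \<open>h\<close> is in the
  image of \<open>\<phi>\<close>: if \<open>h = \<alpha> a + b \<alpha>\<close>, then \<open>j \<alpha> = 0\<close> and \<open>\<alpha> \<pi> = 0\<close> give \<open>j h \<pi> = 0\<close>. Conversely, if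
  \<open>j h \<pi> = 0\<close>, then \<open>h \<pi> = \<alpha> t\<close> for some \<open>t : E \<rightarrow> B\<close>; this \<open>t\<close> vanishes on \<open>A\<close> since
  \<open>Hom(A, B) = 0\<close>, so \<open>t = a \<pi>\<close>, and \<open>(h - \<alpha> a) \<pi> = 0\<close> gives \<open>h - \<alpha> a = b \<alpha>\<close>.
\<close>

section \<open>Arithmetic of morphisms in an additive category\<close>

context additive_category
begin

lemma Hom_ObD:
  assumes "f \<in> Hom C X Y"
  shows "X \<in> Ob C" "Y \<in> Ob C"
  using assms Dom_Ob Cod_Ob by (auto simp: Hom_def)

lemma Zero_Hom:
  assumes "X \<in> Ob C" "Y \<in> Ob C"
  shows "Zero C X Y \<in> Hom C X Y"
proof -
  interpret G: comm_group "Hom_grp C X Y" by (rule Hom_comm_group[OF assms])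
  show ?thesis using G.one_closed by (simp add: Hom_grp_def)
qed

lemma Add_Hom:
  assumes "f \<in> Hom C X Y" "g \<in> Hom C X Y"
  shows "f \<boxplus> g \<in> Hom C X Y"
proof -
  interpret G: comm_group "Hom_grp C X Y" by (rule Hom_comm_group[OF Hom_ObD[OF assms(1)]])
  show ?thesis using G.m_closed assms by (simp add: Hom_grp_def)
qed

lemma Add_Zero:
  assumes "f \<in> Hom C X Y"
  shows "f \<boxplus> Zero C X Y = f"
proof -
  interpret G: comm_group "Hom_grp C X Y" by (rule Hom_comm_group[OF Hom_ObD[OF assms]])
  show ?thesis using G.r_one assms by (simp add: Hom_grp_def)
qed

lemma Add_self_eq_imp_Zero:
  assumes "f \<in> Hom C X Y" "f \<boxplus> f = f"
  shows "f = Zero C X Y"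
proof -
  interpret G: comm_group "Hom_grp C X Y" by (rule Hom_comm_group[OF Hom_ObD[OF assms(1)]])
  show ?thesis using G.l_cancel_one'[of f f] assms by (simp add: Hom_grp_def)
qed

lemma Neg_Hom:
  assumes "f \<in> Hom C X Y"
  shows "Neg C f \<in> Hom C X Y"
proof -
  interpret G: comm_group "Hom_grp C X Y" by (rule Hom_comm_group[OF Hom_ObD[OF assms]])
  show ?thesis using G.inv_closed[of f] assms by (simp add: Neg_def Hom_grp_def Hom_def)
qed

lemma Add_Neg:
  assumes "f \<in> Hom C X Y"
  shows "f \<boxplus> Neg C f = Zero C X Y"
proof -
  interpret G: comm_group "Hom_grp C X Y" by (rule Hom_comm_group[OF Hom_ObD[OF assms]])
  show ?thesis using G.r_inv[of f] assms by (simp add: Neg_def Hom_grp_def Hom_def)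
qed

lemma Neg_unique:
  assumes "f \<in> Hom C X Y" "g \<in> Hom C X Y" "f \<boxplus> g = Zero C X Y"
  shows "g = Neg C f"
proof -
  interpret G: comm_group "Hom_grp C X Y" by (rule Hom_comm_group[OF Hom_ObD[OF assms(1)]])
  show ?thesis
    using G.inv_equality[of g f] G.m_comm[of g f] assms by (simp add: Neg_def Hom_grp_def Hom_def)
qed

lemma Neg_inject:
  assumes "f \<in> Hom C X Y" "g \<in> Hom C X Y" "Neg C f = Neg C g"
  shows "f = g"
proof -
  interpret G: comm_group "Hom_grp C X Y" by (rule Hom_comm_group[OF Hom_ObD[OF assms(1)]])
  show ?thesis using G.inv_inj assms unfolding inj_on_def by (simp add: Neg_def Hom_grp_def Hom_def)
qed

lemma Sub_eq_imp_eq_Add: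
  assumes "f \<in> Hom C X Y" "g \<in> Hom C X Y" "h \<in> Hom C X Y" "f \<boxplus> Neg C g = h"
  shows "f = g \<boxplus> h"
proof -
  interpret G: comm_group "Hom_grp C X Y" by (rule Hom_comm_group[OF Hom_ObD[OF assms(1)]])
  let ?G = "Hom_grp C X Y"
  have c: "f \<in> carrier ?G" "g \<in> carrier ?G" using assms(1,2) by (simp_all add: Hom_grp_def)
  have "Dom C g = X" "Cod C g = Y" using assms(2) by (simp_all add: Hom_def)
  then have h: "h = f \<otimes>\<^bsub>?G\<^esub> inv\<^bsub>?G\<^esub> g" using assms(4) by (simp add: Neg_def Hom_grp_def)
  have "f = g \<otimes>\<^bsub>?G\<^esub> h"
    unfolding h using c by (simp add: G.m_comm[of f "inv\<^bsub>?G\<^esub> g"] G.m_assoc[symmetric])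
  then show ?thesis by (simp add: Hom_grp_def)
qed

lemma Comp_Zero:
  assumes "X \<in> Ob C" "g \<in> Hom C Y Z"
  shows "g \<cdot> Zero C X Y = Zero C X Z"
proof -
  note Z = Zero_Hom[OF assms(1) Hom_ObD(1)[OF assms(2)]]
  show ?thesis
    using Comp_Add[OF Z Z assms(2)] Add_Zero[OF Z]
    by (intro Add_self_eq_imp_Zero Comp_Hom[OF Z assms(2)]) simp
qed

lemma Zero_Comp:
  assumes "Z \<in> Ob C" "f \<in> Hom C X Y"
  shows "Zero C Y Z \<cdot> f = Zero C X Z"
proof -
  note Z = Zero_Hom[OF Hom_ObD(2)[OF assms(2)] assms(1)]
  show ?thesis
    using Add_Comp[OF assms(2) Z Z] Add_Zero[OF Z]
    by (intro Add_self_eq_imp_Zero Comp_Hom[OF assms(2) Z]) simp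
qed

lemma Comp_Neg:
  assumes "f \<in> Hom C X Y" "g \<in> Hom C Y Z"
  shows "g \<cdot> Neg C f = Neg C (g \<cdot> f)"
proof (rule Neg_unique)
  show "g \<cdot> f \<boxplus> g \<cdot> Neg C f = Zero C X Z"
    using Comp_Add[OF assms(1) Neg_Hom[OF assms(1)] assms(2)]
      Add_Neg[OF assms(1)] Comp_Zero[OF Hom_ObD(1)[OF assms(1)] assms(2)] by simp
qed (use assms Comp_Hom Neg_Hom in blast)+

lemma Neg_Comp:
  assumes "f \<in> Hom C X Y" "g \<in> Hom C Y Z"
  shows "Neg C g \<cdot> f = Neg C (g \<cdot> f)"
proof (rule Neg_unique)
  show "g \<cdot> f \<boxplus> Neg C g \<cdot> f = Zero C X Z"
    using Add_Comp[OF assms(1) assms(2) Neg_Hom[OF assms(2)]]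
      Add_Neg[OF assms(2)] Zero_Comp[OF Hom_ObD(2)[OF assms(2)] assms(1)] by simp
qed (use assms Comp_Hom Neg_Hom in blast)+

lemma is_zero_ob_HomD:
  assumes "is_zero_ob C Z"
  shows "f \<in> Hom C X Z \<Longrightarrow> f = Zero C X Z" "f \<in> Hom C Z X \<Longrightarrow> f = Zero C Z X"
  using assms Hom_ObD Zero_Hom unfolding is_zero_ob_def by metis+

lemma is_zero_obI:
  assumes "Z \<in> Ob C" "Ident C Z = Zero C Z Z"
  shows "is_zero_ob C Z"
proof -
  have to: "f = Zero C X Z" if "f \<in> Hom C X Z" for f X
    using that assms Ident_Comp Zero_Comp by metis
  have from_Z: "f = Zero C Z X" if "f \<in> Hom C Z X" for f X
    using that assms Comp_Ident Comp_Zero by metis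
  show ?thesis
    unfolding is_zero_ob_def using assms(1) Zero_Hom to from_Z by metis
qed

end

section \<open>Exactness of Hom on triangles\<close>

context triangulated_category
begin

lemma triangleD:
  assumes "triangle C X Y Z u v w"
  shows "u \<in> Hom C X Y" "v \<in> Hom C Y Z" "w \<in> Hom C Z (Shift_ob C X)"
    "X \<in> Ob C" "Y \<in> Ob C" "Z \<in> Ob C"
  using assms by (auto simp: triangle_def candidate_triangle_def)

lemma triangle_rotate:
  assumes "triangle C X Y Z u v w"
  shows "triangle C Y Z (Shift_ob C X) v w (Neg C (Shift C u))"
  using assms TR2 by (auto simp: triangle_def)

lemma Shift_Zero:
  assumes "X \<in> Ob C" "Y \<in> Ob C"
  shows "Shift C (Zero C X Y) = Zero C (Shift_ob C X) (Shift_ob C Y)"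
  using Shift_Add[OF Zero_Hom[OF assms] Zero_Hom[OF assms]] Add_Zero[OF Zero_Hom[OF assms]]
  by (intro Add_self_eq_imp_Zero Shift_Hom Zero_Hom assms) simp

lemma is_zero_ob_Shift:
  assumes "is_zero_ob C Z"
  shows "is_zero_ob C (Shift_ob C Z)"
proof (rule is_zero_obI)
  have Z: "Z \<in> Ob C" using assms by (simp add: is_zero_ob_def)
  then show "Shift_ob C Z \<in> Ob C" by (rule Shift_Ob)
  have "Ident C Z = Zero C Z Z"
    using is_zero_ob_HomD(1)[OF assms Ident_Hom[OF Z]] .
  then show "Ident C (Shift_ob C Z) = Zero C (Shift_ob C Z) (Shift_ob C Z)"
    using Shift_Ident[OF Z] Shift_Zero[OF Z Z] by simp
qed

text \<open>The triangle rotates to \<open>T \<rightarrow> T \<rightarrow> N[1] \<rightarrow> T[1]\<close>, the identity triangle on \<open>T\<close> with zero object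
  \<open>N[1]\<close>.\<close>

lemma triangle_zero_id:
  assumes "is_zero_ob C N" "T \<in> Ob C"
  shows "triangle C N T T (Zero C N T) (Ident C T) (Zero C T (Shift_ob C N))"
proof -
  have N: "N \<in> Ob C" using assms(1) by (simp add: is_zero_ob_def)
  have SN: "is_zero_ob C (Shift_ob C N)" using is_zero_ob_Shift[OF assms(1)] .
  have cand: "candidate_triangle C N T T (Zero C N T) (Ident C T) (Zero C T (Shift_ob C N))"
    unfolding candidate_triangle_def using N assms(2) Zero_Hom Ident_Hom Shift_Ob by blast
  have "Neg C (Shift C (Zero C N T)) = Zero C (Shift_ob C N) (Shift_ob C T)"
    by (rule is_zero_ob_HomD(2)[OF SN]) (intro Neg_Hom Shift_Hom Zero_Hom N assms(2))
  then show ?thesis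
    using TR2[OF cand] TR1_id[OF assms(2) SN] by simp
qed

lemma triangle_comp_zero:
  assumes t: "triangle C X Y Z u v w"
  shows "v \<cdot> u = Zero C X Z"
proof -
  note d = triangleD[OF t]
  obtain N where N: "is_zero_ob C N" using zero_ob_exists by blast
  have "\<exists>h \<in> Hom C N Z. h \<cdot> Zero C X N = v \<cdot> u \<and>
      Shift C (Ident C X) \<cdot> Zero C N (Shift_ob C X) = w \<cdot> h"
    by (rule TR3[OF TR1_id[OF d(4) N] t Ident_Hom[OF d(4)] d(1)]) simp
  then show ?thesis using Comp_Zero d(4) by metis
qed

text \<open>Exactness of \<open>Hom(-, T)\<close>: extend \<open>f\<close> to a morphism of triangles from the given triangle to
  \<open>0 \<rightarrow> T \<rightarrow> T \<rightarrow> 0[1]\<close>.\<close>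

lemma triangle_factor_right:
  assumes t: "triangle C X Y Z u v w" and f: "f \<in> Hom C Y T" and fu: "f \<cdot> u = Zero C X T"
  obtains h where "h \<in> Hom C Z T" "f = h \<cdot> v"
proof -
  note d = triangleD[OF t]
  obtain N where N: "is_zero_ob C N" using zero_ob_exists by blast
  then have N': "N \<in> Ob C" by (simp add: is_zero_ob_def)
  have T: "T \<in> Ob C" using Hom_ObD[OF f] by simp
  have "f \<cdot> u = Zero C N T \<cdot> Zero C X N"
    using fu Comp_Zero[OF d(4) Zero_Hom[OF N' T]] by simp
  from TR3[OF t triangle_zero_id[OF N T] Zero_Hom[OF d(4) N'] f this]
  obtain h where "h \<in> Hom C Z T" "h \<cdot> v = Ident C T \<cdot> f" by blast
  then show ?thesis using that Ident_Comp[OF f] by metis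
qed

text \<open>Exactness of \<open>Hom(T, -)\<close>: extend \<open>f\<close> to a morphism from the rotated triangle
  \<open>T \<rightarrow> 0 \<rightarrow> T[1] \<rightarrow> T[1]\<close> to the rotation of the given one. Its third component is a morphism
  \<open>T[1] \<rightarrow> X[1]\<close>, which desuspends because the shift is fully faithful.\<close>

lemma triangle_factor_left:
  assumes t: "triangle C X Y Z u v w" and f: "f \<in> Hom C T Y" and vf: "v \<cdot> f = Zero C T Z"
  obtains h where "h \<in> Hom C T X" "f = u \<cdot> h"
proof -
  note d = triangleD[OF t]
  obtain N where N: "is_zero_ob C N" using zero_ob_exists by blast
  then have N': "N \<in> Ob C" by (simp add: is_zero_ob_def)
  have T: "T \<in> Ob C" using Hom_ObD[OF f] by simp
  have "Zero C N Z \<cdot> Zero C T N = v \<cdot> f"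
    using vf Comp_Zero[OF T Zero_Hom[OF N' d(6)]] by simp
  from TR3[OF triangle_rotate[OF TR1_id[OF T N]] triangle_rotate[OF t] f Zero_Hom[OF N' d(6)] this]
  obtain k where k: "k \<in> Hom C (Shift_ob C T) (Shift_ob C X)"
    and eq: "Shift C f \<cdot> Neg C (Shift C (Ident C T)) = Neg C (Shift C u) \<cdot> k" by blast
  obtain h where h: "h \<in> Hom C T X" "k = Shift C h"
    using k Shift_fully_faithful[OF T d(4)] unfolding bij_betw_def by blast
  have uh: "u \<cdot> h \<in> Hom C T Y" using Comp_Hom[OF h(1) d(1)] .
  have "Shift C f \<cdot> Neg C (Shift C (Ident C T)) = Neg C (Shift C f)"
    using Comp_Neg[OF Shift_Hom[OF Ident_Hom[OF T]] Shift_Hom[OF f]]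
      Shift_Comp[OF Ident_Hom[OF T] f] Comp_Ident[OF f] by simp
  moreover have "Neg C (Shift C u) \<cdot> k = Neg C (Shift C (u \<cdot> h))"
    using Neg_Comp[OF Shift_Hom[OF h(1)] Shift_Hom[OF d(1)]] Shift_Comp[OF h(1) d(1)] h(2) by simp
  ultimately have "Neg C (Shift C f) = Neg C (Shift C (u \<cdot> h))"
    using eq by simp
  then have "Shift C f = Shift C (u \<cdot> h)"
    by (rule Neg_inject[OF Shift_Hom[OF f] Shift_Hom[OF uh]])
  then have "f = u \<cdot> h"
    using Shift_fully_faithful[OF T d(5)] f uh by (auto simp: bij_betw_def dest: inj_onD)
  then show ?thesis using that h(1) by blast
qed

text \<open>The shifted triangle carries signs on its morphisms; vanishing statements do not depend on
  them.\<close>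

lemma triangle_shift_by:
  assumes "triangle C X Y Z u v w"
  shows "\<exists>u' v' w'. triangle C (shift_by C k X) (shift_by C k Y) (shift_by C k Z) u' v' w'"
proof (induction k)
  case 0
  then show ?case using assms by (auto simp: shift_by_def)
next
  case (Suc k)
  then obtain u' v' w' where "triangle C (shift_by C k X) (shift_by C k Y) (shift_by C k Z) u' v' w'"
    by blast
  from triangle_rotate[OF triangle_rotate[OF triangle_rotate[OF this]]]
  show ?case by (auto simp: shift_by_def)
qed

lemma Hom_eq_ZeroI:
  assumes "X \<in> Ob C" "Y \<in> Ob C" "\<And>f. f \<in> Hom C X Y \<Longrightarrow> f = Zero C X Y"
  shows "Hom C X Y = {Zero C X Y}"
  using assms Zero_Hom by blast

lemma Hom_into_extension_zero:
  assumes t: "triangle C X Y Z u v w" and T: "T \<in> Ob C"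
    and X: "Hom C T X = {Zero C T X}" and Z: "Hom C T Z = {Zero C T Z}"
  shows "Hom C T Y = {Zero C T Y}"
proof (rule Hom_eq_ZeroI[OF T triangleD(5)[OF t]])
  note d = triangleD[OF t]
  fix f assume f: "f \<in> Hom C T Y"
  have "v \<cdot> f = Zero C T Z" using Comp_Hom[OF f d(2)] Z by blast
  then obtain h where "h \<in> Hom C T X" "f = u \<cdot> h" using triangle_factor_left[OF t f] by blast
  then show "f = Zero C T Y" using X Comp_Zero[OF T d(1)] by auto
qed

lemma Hom_from_extension_zero:
  assumes t: "triangle C X Y Z u v w" and T: "T \<in> Ob C"
    and X: "Hom C X T = {Zero C X T}" and Z: "Hom C Z T = {Zero C Z T}"
  shows "Hom C Y T = {Zero C Y T}"
proof (rule Hom_eq_ZeroI[OF triangleD(5)[OF t] T])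
  note d = triangleD[OF t]
  fix f assume f: "f \<in> Hom C Y T"
  have "f \<cdot> u = Zero C X T" using Comp_Hom[OF d(1) f] X by blast
  then obtain h where "h \<in> Hom C Z T" "f = h \<cdot> v" using triangle_factor_right[OF t f] by blast
  then show "f = Zero C Y T" using Z Zero_Comp[OF T d(2)] by auto
qed

section \<open>Self-extensions of the middle term of a triangle\<close>

text \<open>The case \<open>k = 1\<close>. The right-hand side is surjectivity of \<open>\<phi>\<close>, spelled out elementwise.\<close>

lemma Hom_middle_shift_zero_iff:
  assumes t: "triangle C A E B \<iota> \<pi> \<alpha>"
    and AB: "Hom C A B = {Zero C A B}"
    and AE1: "Hom C A (Shift_ob C E) = {Zero C A (Shift_ob C E)}"
    and BB1: "Hom C B (Shift_ob C B) = {Zero C B (Shift_ob C B)}"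
  shows "Hom C E (Shift_ob C E) = {Zero C E (Shift_ob C E)} \<longleftrightarrow>
    (\<forall>h \<in> Hom C B (Shift_ob C A). \<exists>a \<in> Hom C B B. \<exists>b \<in> Hom C (Shift_ob C A) (Shift_ob C A).
       h = \<alpha> \<cdot> a \<boxplus> b \<cdot> \<alpha>)"
proof -
  note d = triangleD[OF t]
  note t1 = triangle_rotate[OF t]
  note t2 = triangle_rotate[OF t1]
  note t3 = triangle_rotate[OF t2]
  \<comment> \<open>The sign is the one produced by rotating the triangle; it never has to be undone.\<close>
  define j where "j = Neg C (Shift C \<iota>)"
  have j: "j \<in> Hom C (Shift_ob C A) (Shift_ob C E)"
    unfolding j_def by (intro Neg_Hom Shift_Hom d)
  have SE: "Shift_ob C E \<in> Ob C" using Shift_Ob[OF d(5)] .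
  show ?thesis
  proof
    assume E0: "Hom C E (Shift_ob C E) = {Zero C E (Shift_ob C E)}"
    show "\<forall>h \<in> Hom C B (Shift_ob C A). \<exists>a \<in> Hom C B B.
        \<exists>b \<in> Hom C (Shift_ob C A) (Shift_ob C A). h = \<alpha> \<cdot> a \<boxplus> b \<cdot> \<alpha>"
    proof
      fix h assume h: "h \<in> Hom C B (Shift_ob C A)"
      have hp: "h \<cdot> \<pi> \<in> Hom C E (Shift_ob C A)" using Comp_Hom[OF d(2) h] .
      have "j \<cdot> (h \<cdot> \<pi>) = Zero C E (Shift_ob C E)" using Comp_Hom[OF hp j] E0 by blast
      then obtain s where s: "s \<in> Hom C E B" "h \<cdot> \<pi> = \<alpha> \<cdot> s"
        using triangle_factor_left[OF t2 hp] by (auto simp: j_def)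
      have "s \<cdot> \<iota> = Zero C A B" using Comp_Hom[OF d(1) s(1)] AB by blast
      then obtain a where a: "a \<in> Hom C B B" "s = a \<cdot> \<pi>"
        using triangle_factor_right[OF t s(1)] by blast
      have aa: "\<alpha> \<cdot> a \<in> Hom C B (Shift_ob C A)" using Comp_Hom[OF a(1) d(3)] .
      have diff: "h \<boxplus> Neg C (\<alpha> \<cdot> a) \<in> Hom C B (Shift_ob C A)"
        using Add_Hom[OF h Neg_Hom[OF aa]] .
      have "(\<alpha> \<cdot> a) \<cdot> \<pi> = h \<cdot> \<pi>" using s(2) a(2) Comp_assoc[OF d(2) a(1) d(3)] by simp
      then have "(h \<boxplus> Neg C (\<alpha> \<cdot> a)) \<cdot> \<pi> = Zero C E (Shift_ob C A)"
        using Add_Comp[OF d(2) h Neg_Hom[OF aa]] Neg_Comp[OF d(2) aa] Add_Neg[OF hp] by simp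
      then obtain b where b: "b \<in> Hom C (Shift_ob C A) (Shift_ob C A)"
          "h \<boxplus> Neg C (\<alpha> \<cdot> a) = b \<cdot> \<alpha>"
        using triangle_factor_right[OF t1 diff] by blast
      have "h = \<alpha> \<cdot> a \<boxplus> b \<cdot> \<alpha>"
        using Sub_eq_imp_eq_Add[OF h aa Comp_Hom[OF d(3) b(1)] b(2)] .
      then show "\<exists>a \<in> Hom C B B. \<exists>b \<in> Hom C (Shift_ob C A) (Shift_ob C A). h = \<alpha> \<cdot> a \<boxplus> b \<cdot> \<alpha>"
        using a(1) b(1) by blast
    qed
  next
    assume surj: "\<forall>h \<in> Hom C B (Shift_ob C A). \<exists>a \<in> Hom C B B.
        \<exists>b \<in> Hom C (Shift_ob C A) (Shift_ob C A). h = \<alpha> \<cdot> a \<boxplus> b \<cdot> \<alpha>"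
    show "Hom C E (Shift_ob C E) = {Zero C E (Shift_ob C E)}"
    proof (rule Hom_eq_ZeroI[OF d(5) SE])
      fix f assume f: "f \<in> Hom C E (Shift_ob C E)"
      have "f \<cdot> \<iota> = Zero C A (Shift_ob C E)" using Comp_Hom[OF d(1) f] AE1 by blast
      then obtain g where g: "g \<in> Hom C B (Shift_ob C E)" "f = g \<cdot> \<pi>"
        using triangle_factor_right[OF t f] by blast
      have "Neg C (Shift C \<pi>) \<cdot> g = Zero C B (Shift_ob C B)"
        using Comp_Hom[OF g(1) triangleD(2)[OF t3]] BB1 by blast
      then obtain h where h: "h \<in> Hom C B (Shift_ob C A)" "g = j \<cdot> h"
        using triangle_factor_left[OF t3 g(1)] by (auto simp: j_def)
      obtain a b where a: "a \<in> Hom C B B" and b: "b \<in> Hom C (Shift_ob C A) (Shift_ob C A)"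
        and hab: "h = \<alpha> \<cdot> a \<boxplus> b \<cdot> \<alpha>" using surj h(1) by blast
      note aa = Comp_Hom[OF a d(3)] and ba = Comp_Hom[OF d(3) b]
      note jb = Comp_Hom[OF b j]
      have "j \<cdot> (\<alpha> \<cdot> a) = Zero C B (Shift_ob C E)"
        using Comp_assoc[OF a d(3) j] triangle_comp_zero[OF t2] Zero_Comp[OF SE a]
        by (simp add: j_def)
      then have g0: "g = Zero C B (Shift_ob C E) \<boxplus> (j \<cdot> b) \<cdot> \<alpha>"
        using h(2) hab Comp_Add[OF aa ba j] Comp_assoc[OF d(3) b j] by simp
      have "((j \<cdot> b) \<cdot> \<alpha>) \<cdot> \<pi> = Zero C E (Shift_ob C E)"
        using Comp_assoc[OF d(2) d(3) jb] triangle_comp_zero[OF t1] Comp_Zero[OF d(5) jb] by simp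
      then show "f = Zero C E (Shift_ob C E)"
        using g(2) g0 Add_Comp[OF d(2) Zero_Hom[OF d(6) SE] Comp_Hom[OF d(3) jb]]
          Zero_Comp[OF SE d(2)] Add_Zero[OF Zero_Hom[OF d(5) SE]] by simp
    qed
  qed
qed

end

theorem proposition2p3:
  fixes U :: "'u set"
    and D :: "('o, 'm, 'x) tri_cat_scheme"
    and \<sigma>\<^sub>1 \<sigma>\<^sub>2 \<sigma>' :: 'o
    and \<alpha> \<iota> \<pi> :: 'm
  assumes "strongly_inaccessible U"
    and "well_generated U D"
    and "\<sigma>\<^sub>1 \<in> Ob D" and "\<sigma>\<^sub>2 \<in> Ob D"
    and "\<And>k. k > 0 \<Longrightarrow> Hom D \<sigma>\<^sub>1 (shift_by D k \<sigma>\<^sub>1) = {Zero D \<sigma>\<^sub>1 (shift_by D k \<sigma>\<^sub>1)}"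
    and "\<And>k. k > 0 \<Longrightarrow> Hom D \<sigma>\<^sub>2 (shift_by D k \<sigma>\<^sub>2) = {Zero D \<sigma>\<^sub>2 (shift_by D k \<sigma>\<^sub>2)}"
    and "\<And>k. k \<ge> 0 \<Longrightarrow> Hom D \<sigma>\<^sub>1 (shift_by D k \<sigma>\<^sub>2) = {Zero D \<sigma>\<^sub>1 (shift_by D k \<sigma>\<^sub>2)}"
    and "\<And>k. k \<ge> 2 \<Longrightarrow> Hom D \<sigma>\<^sub>2 (shift_by D k \<sigma>\<^sub>1) = {Zero D \<sigma>\<^sub>2 (shift_by D k \<sigma>\<^sub>1)}"
    and "\<alpha> \<in> Hom D \<sigma>\<^sub>2 (Shift_ob D \<sigma>\<^sub>1)"
    and "triangle D \<sigma>\<^sub>1 \<sigma>' \<sigma>\<^sub>2 \<iota> \<pi> \<alpha>"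
  shows "(\<forall>k>0. Hom D \<sigma>' (shift_by D k \<sigma>') = {Zero D \<sigma>' (shift_by D k \<sigma>')}) \<longleftrightarrow>
    (\<lambda>(f, g). \<alpha> \<cdot>\<^bsub>D\<^esub> f \<boxplus>\<^bsub>D\<^esub> g \<cdot>\<^bsub>D\<^esub> \<alpha>) `
      carrier (Hom_grp D \<sigma>\<^sub>2 \<sigma>\<^sub>2 \<times>\<times> Hom_grp D (Shift_ob D \<sigma>\<^sub>1) (Shift_ob D \<sigma>\<^sub>1))
      = carrier (Hom_grp D \<sigma>\<^sub>2 (Shift_ob D \<sigma>\<^sub>1))"
proof -
  interpret triangulated_category D using assms(2) by (simp add: well_generated_def)
  note A = assms(3) and B = assms(4) and AA = assms(5) and BB = assms(6) and AB = assms(7)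
    and BA = assms(8) and t = assms(10)
  have E: "\<sigma>' \<in> Ob D" using triangleD(5)[OF t] .
  have shift_1: "shift_by D 1 X = Shift_ob D X" for X by (simp add: shift_by_def)
  have shift_0: "shift_by D 0 X = X" for X by (simp add: shift_by_def)
  have AE: "Hom D \<sigma>\<^sub>1 (shift_by D k \<sigma>') = {Zero D \<sigma>\<^sub>1 (shift_by D k \<sigma>')}" if "k > 0" for k
    using triangle_shift_by[OF t, of k] Hom_into_extension_zero[OF _ A AA[OF that] AB] by blast
  have BE: "Hom D \<sigma>\<^sub>2 (shift_by D k \<sigma>') = {Zero D \<sigma>\<^sub>2 (shift_by D k \<sigma>')}" if "k \<ge> 2" for k
    using triangle_shift_by[OF t, of k] Hom_into_extension_zero[OF _ B BA[OF that] BB] that by force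
  have EE: "Hom D \<sigma>' (shift_by D k \<sigma>') = {Zero D \<sigma>' (shift_by D k \<sigma>')}" if "k \<ge> 2" for k
  proof -
    have "shift_by D k \<sigma>' \<in> Ob D" using triangle_shift_by[OF t, of k] triangleD(5) by blast
    then show ?thesis using Hom_from_extension_zero[OF t _ AE BE[OF that]] that by simp
  qed
  have "(\<forall>k>0. Hom D \<sigma>' (shift_by D k \<sigma>') = {Zero D \<sigma>' (shift_by D k \<sigma>')}) \<longleftrightarrow>
      Hom D \<sigma>' (Shift_ob D \<sigma>') = {Zero D \<sigma>' (Shift_ob D \<sigma>')}" (is "?L \<longleftrightarrow> ?R")
  proof
    show ?R if ?L using that[rule_format, of 1] by (simp only: shift_1 zero_less_one)
    show ?L if ?R
    proof (intro allI impI)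
      fix k :: nat assume "k > 0"
      then consider "k = 1" | "k \<ge> 2" by linarith
      then show "Hom D \<sigma>' (shift_by D k \<sigma>') = {Zero D \<sigma>' (shift_by D k \<sigma>')}"
        using that EE by cases (simp_all only: shift_1)
    qed
  qed
  also have "\<dots> \<longleftrightarrow> (\<forall>h \<in> Hom D \<sigma>\<^sub>2 (Shift_ob D \<sigma>\<^sub>1). \<exists>a \<in> Hom D \<sigma>\<^sub>2 \<sigma>\<^sub>2.
      \<exists>b \<in> Hom D (Shift_ob D \<sigma>\<^sub>1) (Shift_ob D \<sigma>\<^sub>1). h = \<alpha> \<cdot>\<^bsub>D\<^esub> a \<boxplus>\<^bsub>D\<^esub> b \<cdot>\<^bsub>D\<^esub> \<alpha>)"
  proof (rule Hom_middle_shift_zero_iff[OF t])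
    show "Hom D \<sigma>\<^sub>1 \<sigma>\<^sub>2 = {Zero D \<sigma>\<^sub>1 \<sigma>\<^sub>2}"
      using AB[of 0] by (simp add: shift_0)
    show "Hom D \<sigma>\<^sub>1 (Shift_ob D \<sigma>') = {Zero D \<sigma>\<^sub>1 (Shift_ob D \<sigma>')}"
      using AE[of 1] by (simp only: shift_1 zero_less_one)
    show "Hom D \<sigma>\<^sub>2 (Shift_ob D \<sigma>\<^sub>2) = {Zero D \<sigma>\<^sub>2 (Shift_ob D \<sigma>\<^sub>2)}"
      using BB[of 1] by (simp only: shift_1 zero_less_one)
  qed
  also have "\<dots> \<longleftrightarrow> (\<lambda>(f, g). \<alpha> \<cdot>\<^bsub>D\<^esub> f \<boxplus>\<^bsub>D\<^esub> g \<cdot>\<^bsub>D\<^esub> \<alpha>) `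
      (Hom D \<sigma>\<^sub>2 \<sigma>\<^sub>2 \<times> Hom D (Shift_ob D \<sigma>\<^sub>1) (Shift_ob D \<sigma>\<^sub>1)) = Hom D \<sigma>\<^sub>2 (Shift_ob D \<sigma>\<^sub>1)"
  proof -
    have "(\<lambda>(f, g). \<alpha> \<cdot>\<^bsub>D\<^esub> f \<boxplus>\<^bsub>D\<^esub> g \<cdot>\<^bsub>D\<^esub> \<alpha>) `
        (Hom D \<sigma>\<^sub>2 \<sigma>\<^sub>2 \<times> Hom D (Shift_ob D \<sigma>\<^sub>1) (Shift_ob D \<sigma>\<^sub>1)) \<subseteq> Hom D \<sigma>\<^sub>2 (Shift_ob D \<sigma>\<^sub>1)"
      using assms(9) by (auto intro!: Add_Hom intro: Comp_Hom)
    moreover have "(\<forall>h \<in> Hom D \<sigma>\<^sub>2 (Shift_ob D \<sigma>\<^sub>1). \<exists>a \<in> Hom D \<sigma>\<^sub>2 \<sigma>\<^sub>2.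
        \<exists>b \<in> Hom D (Shift_ob D \<sigma>\<^sub>1) (Shift_ob D \<sigma>\<^sub>1). h = \<alpha> \<cdot>\<^bsub>D\<^esub> a \<boxplus>\<^bsub>D\<^esub> b \<cdot>\<^bsub>D\<^esub> \<alpha>) \<longleftrightarrow>
        Hom D \<sigma>\<^sub>2 (Shift_ob D \<sigma>\<^sub>1) \<subseteq> (\<lambda>(f, g). \<alpha> \<cdot>\<^bsub>D\<^esub> f \<boxplus>\<^bsub>D\<^esub> g \<cdot>\<^bsub>D\<^esub> \<alpha>) `
          (Hom D \<sigma>\<^sub>2 \<sigma>\<^sub>2 \<times> Hom D (Shift_ob D \<sigma>\<^sub>1) (Shift_ob D \<sigma>\<^sub>1))"
      by (simp add: subset_iff image_iff Ball_def Bex_def)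
    ultimately show ?thesis by blast
  qed
  finally show ?thesis by (simp add: DirProd_def Hom_grp_def)
qed

end
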